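(* Let $g_{m,k}^s\in\mathbb{S}^{d_g-1}$ be the normalized image feature of the $k$-th candidate for subject $s$ and prompt $m$, let $\bar g_s\in\mathbb{S}^{d_g-1}$ be the normalized reference center of subject $s$, let $I_{m,k}^s=\mathrm{sim}(g_{m,k}^s,\bar g_s)$ be the identity score, and for a threshold $\eta\in[-1,1]$ let $\mathcal{C}_{m,\eta}^s=\{k: I_{m,k}^s\geq\eta\}$. If $g_{m,k}^s$ and $\bar g_s$ are unit vectors and $k\in\mathcal{C}_{m,\eta}^s$, then the candidate feature satisfies $$\|g_{m,k}^s-\bar g_s\|_2^2\leq 2(1-\eta).$$ Furthermore, if every candidate in a selected set $\mathcal{A}_s$ satisfies the identity threshold $\eta$ (that is, its identity score is at least $\eta$), then the mean squared radius of $\mathcal{A}_s$ around the reference center $\bar g_s$ is at most $2(1-\eta)$.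
   Context: $\mathbb{S}^{d-1}$ is the Euclidean unit sphere in $\mathbb{R}^d$. For nonzero vectors $a,b$, the cosine similarity is $\mathrm{sim}(a,b)=\frac{a^\top b}{\|a\|_2\|b\|_2}$. Prompts are indexed by $m\in\{1,\ldots,M\}$ and the candidates generated for one subject and prompt by $k\in\{1,\ldots,K\}$. $\mathcal{A}_s$ is a set of candidates selected for subject $s$; its mean squared radius around $\bar g_s$ is the average over the candidates in $\mathcal{A}_s$ of the squared Euclidean distance from the candidate's normalized feature to $\bar g_s$. *)

theory Defs
  imports "HOL-Analysis.Analysis"
begin

definition cos_sim :: "real ^ 'd \<Rightarrow> real ^ 'd \<Rightarrow> real" where
  "cos_sim a b = (a \<bullet> b) / (norm a * norm b)"

(* g s m k is the image feature of the k-th candidate for subject s and prompt m;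
   gbar s is the reference center of subject s. *)
definition identity_score ::
  "('s \<Rightarrow> nat \<Rightarrow> nat \<Rightarrow> real ^ 'd) \<Rightarrow> ('s \<Rightarrow> real ^ 'd) \<Rightarrow> 's \<Rightarrow> nat \<Rightarrow> nat \<Rightarrow> real" where
  "identity_score g gbar s m k = cos_sim (g s m k) (gbar s)"

definition admissible ::
  "('s \<Rightarrow> nat \<Rightarrow> nat \<Rightarrow> real ^ 'd) \<Rightarrow> ('s \<Rightarrow> real ^ 'd) \<Rightarrow> nat \<Rightarrow> real \<Rightarrow> 's \<Rightarrow> nat \<Rightarrow> nat set" where
  "admissible g gbar K \<eta> s m = {k \<in> {1..K}. identity_score g gbar s m k \<ge> \<eta>}"

(* A is a finite set of candidates (m, k), not of feature vectors: distinct candidates with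
   equal features are counted separately. For empty A the value is 0. *)
definition mean_sq_radius ::
  "('s \<Rightarrow> nat \<Rightarrow> nat \<Rightarrow> real ^ 'd) \<Rightarrow> ('s \<Rightarrow> real ^ 'd) \<Rightarrow> 's \<Rightarrow> (nat \<times> nat) set \<Rightarrow> real" where
  "mean_sq_radius g gbar s A = (\<Sum>(m, k)\<in>A. (norm (g s m k - gbar s))\<^sup>2) / real (card A)"

end

theory Submission
  imports Defs
begin

text \<open>For unit vectors, expanding the squared distance gives 1 + 1 minus twice the inner
  product, and that inner product is the cosine similarity. So a lower bound on the identity score
  is exactly an upper bound on the squared distance to the center
  (\<open>norm_diff_sq_eq_cos_sim\<close>). The bound is uniform over candidates, so it passes to
  their average (\<open>mean_sq_radius_le\<close>).\<close>

lemma norm_diff_sq_eq_cos_sim: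
  assumes "norm a = 1" "norm b = 1"
  shows "(norm (a - b))\<^sup>2 = 2 * (1 - cos_sim a b)"
proof -
  have "a \<bullet> a = 1" "b \<bullet> b = 1"
    using assms by (simp_all add: dot_square_norm)
  then show ?thesis
    using assms by (simp add: cos_sim_def power2_norm_eq_inner inner_diff inner_commute)
qed

lemma norm_diff_sq_le_of_identity_score:
  assumes "norm (g s m k) = 1" "norm (gbar s) = 1" "identity_score g gbar s m k \<ge> \<eta>"
  shows "(norm (g s m k - gbar s))\<^sup>2 \<le> 2 * (1 - \<eta>)"
  using assms by (simp add: norm_diff_sq_eq_cos_sim identity_score_def)

text \<open>An average of terms bounded by \<open>c\<close> is bounded by \<open>c\<close>; the sign
  condition on \<open>c\<close> handles the case where the mean takes its default value 0.\<close>

lemma mean_sq_radius_le: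
  assumes "c \<ge> 0" and "\<And>m k. (m, k) \<in> A \<Longrightarrow> (norm (g s m k - gbar s))\<^sup>2 \<le> c"
  shows "mean_sq_radius g gbar s A \<le> c"
\<comment> \<open>Cardinality 0 means that \<open>A\<close> is empty or infinite; division by zero
  then makes the mean 0.\<close>
proof (cases "card A = 0")
  case True
  then show ?thesis
    using assms(1) by (simp add: mean_sq_radius_def)
next
  case False
  have "(\<Sum>(m, k)\<in>A. (norm (g s m k - gbar s))\<^sup>2) \<le> real (card A) * c"
    using assms(2) by (intro sum_bounded_above) auto
  then show ?thesis
    using False by (simp add: mean_sq_radius_def field_simps)
qed

theorem proposition4p6:
  fixes g :: "'s \<Rightarrow> nat \<Rightarrow> nat \<Rightarrow> real ^ 'd"
    and gbar :: "'s \<Rightarrow> real ^ 'd"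
    and s :: 's
    and M K :: nat
    and \<eta> :: real
  assumes "\<And>m k. m \<in> {1..M} \<Longrightarrow> k \<in> {1..K} \<Longrightarrow> g s m k \<in> sphere 0 1"
    and "gbar s \<in> sphere 0 1"
    and "\<eta> \<in> {-1..1}"
  shows "(\<forall>m\<in>{1..M}. \<forall>k\<in>admissible g gbar K \<eta> s m.
            (norm (g s m k - gbar s))\<^sup>2 \<le> 2 * (1 - \<eta>)) \<and>
         (\<forall>A \<subseteq> {1..M} \<times> {1..K}.
            (\<forall>(m, k)\<in>A. identity_score g gbar s m k \<ge> \<eta>) \<longrightarrow>
            mean_sq_radius g gbar s A \<le> 2 * (1 - \<eta>))"
proof (intro conjI ballI allI impI)
  fix m k
  assume "m \<in> {1..M}" "k \<in> admissible g gbar K \<eta> s m"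
  then show "(norm (g s m k - gbar s))\<^sup>2 \<le> 2 * (1 - \<eta>)"
    using assms(1)[of m k] assms(2)
    by (intro norm_diff_sq_le_of_identity_score) (auto simp: admissible_def)
next
  fix A
  assume A: "A \<subseteq> {1..M} \<times> {1..K}" and score: "\<forall>(m, k)\<in>A. identity_score g gbar s m k \<ge> \<eta>"
  show "mean_sq_radius g gbar s A \<le> 2 * (1 - \<eta>)"
  proof (rule mean_sq_radius_le)
    \<comment> \<open>Here \<eta> \<le> 1 enters: it secures the bound for empty \<open>A\<close>,
      where no candidate witnesses it.\<close>
    show "2 * (1 - \<eta>) \<ge> 0"
      using assms(3) by simp
  next
    fix m k
    assume mk: "(m, k) \<in> A"
    with A have "m \<in> {1..M}" "k \<in> {1..K}"
      by auto
    then show "(norm (g s m k - gbar s))\<^sup>2 \<le> 2 * (1 - \<eta>)"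
      using assms(1)[of m k] assms(2) score mk
      by (intro norm_diff_sq_le_of_identity_score) auto
  qed
qed

end
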